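(* Let $k\ge 1$ be an odd integer and let $l\ge 2$ be an even integer with $l\le k+1$. Put $d=\frac{3k}{2}+\frac{l+1}{2}$ and $m=d-(k+l)=\frac{k+1-l}{2}$. Let $\beta_u=2(l+u-1)$ and $\gamma_u=k+l+u$ for $u=1,\ldots,m$ (so that $\beta_1,\ldots,\beta_m$ are $2l,2l+2,\ldots,k+l-1$ and $\gamma_1,\ldots,\gamma_m$ are $k+l+1,k+l+2,\ldots,d$). Let $T$ be the sequence of length $4k+2l$ obtained by writing twice in succession the sequence of length $2k+l$ $$\underbrace{1,2,\ldots,k+l}_{\text{length } k+l},\ \underbrace{2,4,\ldots,2l-2}_{\text{length } l-1},\ \underbrace{\gamma_1,\beta_1,\gamma_2,\beta_2,\ldots,\gamma_m,\beta_m}_{\text{length } k+1-l}.$$ Then $T$ is the transition sequence of a (symmetric) circuit code $C\in\mathcal{F}(d,k,k+l)$ of length $4k+2l$.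
   Context: $I(d)$ is the graph of the $d$-dimensional hypercube (vertices are binary vectors of length $d$; edges join vectors differing in exactly one position). For a graph $G$, $d_G(x,y)$ is the graph distance in $G$. A circuit in $I(d)$ is a simple cycle $C=(x_1,\ldots,x_N)$ in $I(d)$; its length is $N$. A $(d,k)$ circuit code (circuit code of spread $k$ in dimension $d$) is a circuit $C$ in $I(d)$ such that for all vertices $x,y$ of $C$, $d_{I(d)}(x,y)<k$ implies $d_C(x,y)=d_{I(d)}(x,y)$. The transition sequence of $C$ is $(\tau_1,\ldots,\tau_N)$, where $\tau_i\in\{1,\ldots,d\}$ is the position in which $x_i$ and $x_{i+1}$ differ (indices mod $N$). By convention $x_1=\vec 0$, so the transition sequence determines $C$. A segment of a transition sequence is a subsequence of cyclically consecutive elements. The maximum bit run $\phi(C)$ is the length of the longest segment of the transition sequence in which no transition is repeated. $\mathcal{F}(d,k,r)$ is the set of $(d,k)$ circuit codes $C$ with $\phi(C)\ge r$. A circuit code is symmetric if its transition sequence satisfies $\tau_i=\tau_{i+N/2}$ for $1\le i\le N/2$. *)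

theory Defs
  imports Complex_Main "Graph_Theory.Graph_Theory"
begin

text \<open>
  An undirected simple graph is a \<^typ>\<open>'a pair_pre_digraph\<close> whose arc relation is symmetric and
  irreflexive (locale \<^locale>\<open>pair_graph\<close>), so every edge is a pair of opposite arcs.
  The graph distance is the least cost of a walk in which every arc costs 1.
\<close>

definition graph_dist :: "'a pair_pre_digraph \<Rightarrow> 'a \<Rightarrow> 'a \<Rightarrow> ereal" where
  "graph_dist G x y = wf_digraph.\<mu> (with_proj G) (\<lambda>_. 1) x y"

text \<open>Positions of a vector are numbered from 1, as in the transition sequences.\<close>

definition differing_positions :: "bool list \<Rightarrow> bool list \<Rightarrow> nat set" where
  "differing_positions x y = {p \<in> {1..length x}. x ! (p - 1) \<noteq> y ! (p - 1)}"

definition hypercube :: "nat \<Rightarrow> bool list pair_pre_digraph" where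
  "hypercube d =
     \<lparr> pverts = {x. length x = d},
       parcs = {(x, y). length x = d \<and> length y = d \<and> card (differing_positions x y) = 1} \<rparr>"

text \<open>
  A circuit is the list of its vertices, the closing edge from the last vertex back to the first
  one being implicit. Requiring at least three vertices excludes a single edge traversed back
  and forth, which \<^const>\<open>pre_digraph.cycle\<close> would admit.
\<close>

definition circuit :: "nat \<Rightarrow> bool list list \<Rightarrow> bool" where
  "circuit d C \<longleftrightarrow> 3 \<le> length C \<and> distinct C \<and>
     (\<forall>i < length C. (C ! i, C ! (Suc i mod length C)) \<in> parcs (hypercube d))"

definition cycle_arcs :: "'a list \<Rightarrow> ('a \<times> 'a) set" where
  "cycle_arcs C = {(C ! i, C ! (Suc i mod length C)) | i. i < length C}"

definition cycle_graph :: "'a list \<Rightarrow> 'a pair_pre_digraph" where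
  "cycle_graph C = \<lparr> pverts = set C, parcs = cycle_arcs C \<union> (cycle_arcs C)\<inverse> \<rparr>"

definition circuit_code :: "nat \<Rightarrow> nat \<Rightarrow> bool list list \<Rightarrow> bool" where
  "circuit_code d k C \<longleftrightarrow> circuit d C \<and>
     (\<forall>x \<in> set C. \<forall>y \<in> set C. graph_dist (hypercube d) x y < ereal (real k) \<longrightarrow>
        graph_dist (cycle_graph C) x y = graph_dist (hypercube d) x y)"

definition transition_sequence :: "bool list list \<Rightarrow> nat list" where
  "transition_sequence C =
     map (\<lambda>i. the_elem (differing_positions (C ! i) (C ! (Suc i mod length C)))) [0..<length C]"

text \<open>A segment is cyclic, but has at most as many elements as the sequence itself.\<close>

definition segments :: "'a list \<Rightarrow> 'a list set" where
  "segments \<tau> = {take n (rotate i \<tau>) | i n. n \<le> length \<tau>}"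

definition max_bit_run :: "bool list list \<Rightarrow> nat" where
  "max_bit_run C = Max {length s | s. s \<in> segments (transition_sequence C) \<and> distinct s}"

definition circuit_codes_run :: "nat \<Rightarrow> nat \<Rightarrow> nat \<Rightarrow> bool list list set" where
  "circuit_codes_run d k r = {C. circuit_code d k C \<and> r \<le> max_bit_run C}"

definition symmetric_circuit :: "bool list list \<Rightarrow> bool" where
  "symmetric_circuit C \<longleftrightarrow> even (length C) \<and>
     (\<forall>i < length C div 2.
        transition_sequence C ! i = transition_sequence C ! (i + length C div 2))"

lemma finite_differing_positions: "finite (differing_positions x y)"
  by (simp add: differing_positions_def)

lemma finite_vectors: "finite {x :: bool list. length x = d}"
  using finite_lists_length_eq[of "UNIV :: bool set" d] by simp

lemma differing_positions_commute:
  "length x = length y \<Longrightarrow> differing_positions x y = differing_positions y x"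
  by (auto simp: differing_positions_def)

lemma pair_graph_hypercube: "pair_graph (hypercube d)"
proof
  show "finite (pverts (hypercube d))"
    by (simp add: hypercube_def finite_vectors)
  have "parcs (hypercube d) \<subseteq> pverts (hypercube d) \<times> pverts (hypercube d)"
    by (auto simp: hypercube_def)
  then show "finite (parcs (hypercube d))"
    by (rule finite_subset) (simp add: hypercube_def finite_vectors)
  show "symmetric (with_proj (hypercube d))"
    by (auto simp: symmetric_def sym_def hypercube_def differing_positions_commute)
  show "fst e \<in> pverts (hypercube d)" "snd e \<in> pverts (hypercube d)"
    if "e \<in> parcs (hypercube d)" for e
    using that by (cases e, simp add: hypercube_def)+
  show "fst e \<noteq> snd e" if "e \<in> parcs (hypercube d)" for e
  proof
    assume "fst e = snd e"
    then show False
      using that by (cases e) (simp add: hypercube_def differing_positions_def)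
  qed
qed

lemma pair_graph_cycle_graph:
  assumes "circuit d C"
  shows "pair_graph (cycle_graph C)"
proof
  have C: "set C \<noteq> {}" "length C > 0"
    using assms by (auto simp: circuit_def)
  have sub: "parcs (cycle_graph C) \<subseteq> set C \<times> set C"
    using C by (auto simp: cycle_graph_def cycle_arcs_def)
  show "finite (pverts (cycle_graph C))"
    by (simp add: cycle_graph_def)
  show "finite (parcs (cycle_graph C))"
    using sub by (rule finite_subset) simp
  show "symmetric (with_proj (cycle_graph C))"
    by (auto simp: symmetric_def sym_def cycle_graph_def)
  show "fst e \<in> pverts (cycle_graph C)" "snd e \<in> pverts (cycle_graph C)"
    if "e \<in> parcs (cycle_graph C)" for e
    using that sub by (auto simp: cycle_graph_def)
  have arc: "(x, y) \<in> parcs (hypercube d)" if "(x, y) \<in> cycle_arcs C" for x y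
    using that assms by (auto simp: cycle_arcs_def circuit_def)
  have loopfree: "(x, x) \<notin> parcs (hypercube d)" for x
    by (simp add: hypercube_def differing_positions_def)
  show "fst e \<noteq> snd e" if "e \<in> parcs (cycle_graph C)" for e
  proof
    assume eq: "fst e = snd e"
    then have "(fst e, fst e) \<in> cycle_arcs C"
      using that by (cases e) (simp add: cycle_graph_def)
    then show False
      using arc loopfree by blast
  qed
qed

end

theory Submission
  imports Defs
begin

text \<open>
  The differing positions of two vertices are the values that occur an odd number of times
  between them in the transition sequence, so it suffices for spread \<open>k\<close> that every cyclic window
  of \<open>n\<close> transitions, with \<open>n\<close> at most half the length, has at least \<open>min n k\<close> such values.
  In one period of length \<open>2 * k + l\<close> only the even values below \<open>k + l\<close> repeat, each exactly once.
  Hence a window has at least \<open>n - 2 * P\<close> odd values, where \<open>P\<close> counts the values repeated in it,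
  and \<open>2 * P \<le> n - k\<close> (truncated) because repetitions are more than \<open>k\<close> apart and their start
  or end positions run over every second position.
\<close>

section \<open>Distances in subgraphs of the hypercube\<close>

lemma graph_dist_conv_Inf:
  assumes "pair_graph G"
  shows "graph_dist G x y = (INF p \<in> {p. pre_digraph.awalk (with_proj G) x p y}. ereal (length p))"
proof -
  interpret pair_graph G by fact
  have "awalk_cost (\<lambda>_. 1) p = real (length p)" for p
    by (induction p) simp_all
  then show ?thesis
    by (simp add: graph_dist_def \<mu>_def)
qed

lemma length_rev_path: "length (rev_path p) = length p"
  by (induction p) auto

lemma graph_dist_commute:
  assumes "pair_graph G"
  shows "graph_dist G x y = graph_dist G y x"
proof -
  interpret pair_graph G by fact
  have "graph_dist G u v \<le> graph_dist G v u" for u v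
    unfolding graph_dist_conv_Inf[OF assms]
  proof (rule INF_mono)
    fix p assume "p \<in> {p. awalk v p u}"
    then have "awalk u (rev_path p) v" by simp
    then show "\<exists>q\<in>{q. awalk u q v}. ereal (length q) \<le> ereal (length p)"
      by (intro bexI[of _ "rev_path p"]) (simp_all add: length_rev_path)
  qed
  then show ?thesis by (simp add: antisym)
qed

lemma card_differing_positions_triangle:
  assumes "length x = length y"
  shows "card (differing_positions x z) \<le> card (differing_positions x y) + card (differing_positions y z)"
proof -
  have "differing_positions x z \<subseteq> differing_positions x y \<union> differing_positions y z"
    using assms by (auto simp: differing_positions_def)
  then have "card (differing_positions x z) \<le> card (differing_positions x y \<union> differing_positions y z)"
    by (simp add: card_mono finite_differing_positions)
  then show ?thesis
    using card_Un_le le_trans by blast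
qed

text \<open>Each arc flips one position, so by the triangle inequality no walk is shorter than the
  Hamming distance of its ends. Allowing any subgraph of the cube covers the cycle graph as
  well.\<close>

lemma card_differing_positions_le_walk:
  assumes "pair_graph G" and "parcs G \<subseteq> parcs (hypercube d)"
    and "pre_digraph.awalk (with_proj G) x p y"
  shows "card (differing_positions x y) \<le> length p"
  using assms(3)
proof (induction p arbitrary: x)
  case Nil
  interpret pair_graph G by fact
  show ?case
    using Nil by (simp add: awalk_Nil_iff differing_positions_def)
next
  case (Cons e p)
  interpret pair_graph G by fact
  from Cons.prems obtain z where e: "e = (x, z)" "(x, z) \<in> parcs G" "awalk z p y"
    by (cases e) (auto simp: awalk_Cons_iff)
  then have "length x = length z" "card (differing_positions x z) = 1"
    using assms(2) by (auto simp: hypercube_def)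
  then show ?case
    using card_differing_positions_triangle[of x z y] Cons.IH[OF e(3)] by simp
qed

text \<open>An infinite sequence lets a periodic numbering of the vertices pass the closing edge
  without index reduction.\<close>

lemma walk_along_sequence:
  assumes "pair_graph G" and "X a \<in> pverts G" and "\<And>i. (X i, X (Suc i)) \<in> parcs G"
  shows "\<exists>p. pre_digraph.awalk (with_proj G) (X a) p (X (a + n)) \<and> length p = n"
proof (induction n)
  interpret pair_graph G by fact
  case 0
  show ?case using assms(2) by (auto simp: awalk_Nil_iff)
next
  interpret pair_graph G by fact
  case (Suc n)
  then obtain p where p: "awalk (X a) p (X (a + n))" "length p = n" by blast
  have "awalk (X (a + n)) [(X (a + n), X (Suc (a + n)))] (X (Suc (a + n)))"
    using assms(3)[of "a + n"] by (auto simp: awalk_simps dest: in_arcsD2)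
  with p show ?case
    by (intro exI[of _ "p @ [(X (a + n), X (Suc (a + n)))]"]) auto
qed

text \<open>The Hamming distance bounds all walks from below and the walk along \<open>X\<close>
  attains it. Applied to the cycle graph and to the cube, this makes the two distances
  agree.\<close>

lemma graph_dist_along_sequence:
  assumes G: "pair_graph G" "parcs G \<subseteq> parcs (hypercube d)"
    and X: "X a \<in> pverts G" "\<And>i. (X i, X (Suc i)) \<in> parcs G"
    and n: "card (differing_positions (X a) (X (a + n))) = n"
  shows "graph_dist G (X a) (X (a + n)) = ereal (real n)"
proof (rule antisym)
  obtain p where "pre_digraph.awalk (with_proj G) (X a) p (X (a + n))" "length p = n"
    using walk_along_sequence[of G X, OF G(1) X] by blast
  then show "graph_dist G (X a) (X (a + n)) \<le> ereal (real n)"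
    unfolding graph_dist_conv_Inf[OF G(1)] by (intro INF_lower2[of p]) auto
  show "ereal (real n) \<le> graph_dist G (X a) (X (a + n))"
    unfolding graph_dist_conv_Inf[OF G(1)]
    using card_differing_positions_le_walk[OF G, of "X a" _ "X (a + n)"] n
    by (intro INF_greatest) auto
qed

lemma card_differing_positions_le_graph_dist:
  "ereal (real (card (differing_positions x y))) \<le> graph_dist (hypercube d) x y"
  unfolding graph_dist_conv_Inf[OF pair_graph_hypercube]
  using card_differing_positions_le_walk[OF pair_graph_hypercube order_refl, of d x _ y]
  by (intro INF_greatest) auto

section \<open>Circuit codes from periodic transition sequences\<close>

text \<open>List index \<open>v\<close> stands for position \<open>Suc v\<close>, since transitions
  are numbered from 1.\<close>

definition prefix_vector :: "nat \<Rightarrow> (nat \<Rightarrow> nat) \<Rightarrow> nat \<Rightarrow> bool list" where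
  "prefix_vector d w i = map (\<lambda>v. odd (card {s \<in> {0..<i}. w s = Suc v})) [0..<d]"

definition odd_values :: "(nat \<Rightarrow> nat) \<Rightarrow> nat \<Rightarrow> nat \<Rightarrow> nat set" where
  "odd_values w i j = {v. odd (card {s \<in> {i..<j}. w s = v})}"

lemma length_prefix_vector [simp]: "length (prefix_vector d w i) = d"
  by (simp add: prefix_vector_def)

lemma nth_prefix_vector:
  "v < d \<Longrightarrow> prefix_vector d w i ! v \<longleftrightarrow> odd (card {s \<in> {0..<i}. w s = Suc v})"
  by (simp add: prefix_vector_def)

lemma card_occurrences_split:
  fixes w :: "nat \<Rightarrow> 'a"
  assumes "i \<le> j"
  shows "card {s \<in> {0..<j}. w s = v} = card {s \<in> {0..<i}. w s = v} + card {s \<in> {i..<j}. w s = v}"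
proof -
  have "{s \<in> {0..<j}. w s = v} = {s \<in> {0..<i}. w s = v} \<union> {s \<in> {i..<j}. w s = v}"
    using assms by auto
  then have "card {s \<in> {0..<j}. w s = v} = card ({s \<in> {0..<i}. w s = v} \<union> {s \<in> {i..<j}. w s = v})"
    by (rule arg_cong)
  also have "\<dots> = card {s \<in> {0..<i}. w s = v} + card {s \<in> {i..<j}. w s = v}"
    by (rule card_Un_disjoint) auto
  finally show ?thesis .
qed

text \<open>The counts up to \<open>i\<close> and up to \<open>j\<close> differ by the count in
  between, so their parities differ exactly when that count is odd. The range of \<open>w\<close>
  keeps all odd values among the coordinates.\<close>

lemma differing_positions_prefix_vector:
  assumes "i \<le> j" and "range w \<subseteq> {1..d}"
  shows "differing_positions (prefix_vector d w i) (prefix_vector d w j) = odd_values w i j"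
proof -
  have "v \<in> {1..d}" if "odd (card {s \<in> {i..<j}. w s = v})" for v
  proof -
    from that have "{s \<in> {i..<j}. w s = v} \<noteq> {}" by (metis card.empty even_zero)
    then obtain s where "v = w s" by auto
    with assms(2) show ?thesis by blast
  qed
  then show ?thesis
    using card_occurrences_split[OF assms(1), of w]
    by (fastforce simp: differing_positions_def odd_values_def nth_prefix_vector)
qed

lemma odd_values_singleton: "odd_values w i (Suc i) = {w i}"
proof -
  have "{s \<in> {i..<Suc i}. w s = v} = (if v = w i then {i} else {})" for v
    by (auto simp: less_Suc_eq)
  then show ?thesis by (auto simp: odd_values_def)
qed

lemma card_periodic_occurrences:
  fixes w :: "nat \<Rightarrow> 'a"
  assumes "\<And>s. w (s + N) = w s"
  shows "card {s \<in> {N..<N + i}. w s = v} = card {s \<in> {0..<i}. w s = v}"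
proof -
  have "{s \<in> {N..<N + i}. w s = v} = (\<lambda>s. s + N) ` {s \<in> {0..<i}. w s = v}" (is "?A = ?f ` ?B")
  proof
    show "?A \<subseteq> ?f ` ?B"
    proof
      fix s assume "s \<in> ?A"
      then have "s - N \<in> ?B" "s = ?f (s - N)"
        using assms[of "s - N"] by auto
      then show "s \<in> ?f ` ?B" by (rule rev_image_eqI)
    qed
  qed (use assms in auto)
  then show ?thesis by (simp add: card_image)
qed

lemma prefix_vector_periodic:
  assumes "\<And>s. w (s + N) = w s" and "\<And>v. even (card {s \<in> {0..<N}. w s = v})"
  shows "prefix_vector d w (i + N) = prefix_vector d w i"
  using assms(2) card_occurrences_split[of N "i + N" w]
    card_periodic_occurrences[of w N i, OF assms(1)]
  by (simp add: prefix_vector_def add.commute)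

text \<open>One of the two arcs joining two vertices has at most \<open>N / 2\<close> edges, so
  \<open>spread\<close> speaks about every pair. It serves twice: it makes the vertices distinct,
  and for cube distance below \<open>k\<close> it forces that arc to be geodesic in the cube, hence
  also in the cycle.\<close>

lemma circuit_code_of_transitions:
  assumes w: "range w \<subseteq> {1..d}" "\<And>s. w (s + N) = w s"
    and closed: "\<And>v. even (card {s \<in> {0..<N}. w s = v})"
    and N: "3 \<le> N" and k: "1 \<le> k"
    and spread: "\<And>a n. 2 * n \<le> N \<Longrightarrow> min n k \<le> card (odd_values w a (a + n))"
  defines "C \<equiv> map (prefix_vector d w) [0..<N]"
  shows "circuit_code d k C" and "transition_sequence C = map w [0..<N]"
proof -
  let ?X = "prefix_vector d w"
  let ?D = "\<lambda>x y. card (differing_positions x y)"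
  have period: "?X (i + N) = ?X i" for i
    by (rule prefix_vector_periodic[OF w(2) closed])
  have mod: "?X (i mod N) = ?X i" for i
  proof -
    have "?X (r + q * N) = ?X r" for r q
    proof (induction q)
      case (Suc q)
      then show ?case using period[of "r + q * N"] by (simp add: ac_simps)
    qed simp
    from this[of "i mod N" "i div N"] show ?thesis by simp
  qed
  have nth: "C ! i = ?X i" if "i < N" for i
    using that by (simp add: C_def)
  have nth_Suc: "C ! (Suc i mod N) = ?X (Suc i)" if "i < N" for i
    using nth[of "Suc i mod N"] that mod by simp
  have len: "length C = N" by (simp add: C_def)
  have edge: "differing_positions (?X i) (?X (Suc i)) = {w i}" for i
    using differing_positions_prefix_vector[OF _ w(1), of i "Suc i"]
    by (simp add: odd_values_singleton)
  show ts: "transition_sequence C = map w [0..<N]"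
    unfolding transition_sequence_def len
    by (rule map_cong) (simp_all only: atLeastLessThan_iff set_upt nth nth_Suc edge the_elem_eq)
  have arc: "(?X i, ?X (Suc i)) \<in> parcs (hypercube d)" for i
    by (simp add: hypercube_def edge)
  have dist: "min n k \<le> ?D (?X a) (?X (a + n))" if "2 * n \<le> N" for a n
    using differing_positions_prefix_vector[OF _ w(1), of a "a + n"] spread[OF that, of a]
    by simp
  have shorter_arc: "\<exists>a n. 2 * n \<le> N \<and> (n = 0 \<longrightarrow> i = j) \<and>
      (?X i = ?X a \<and> ?X j = ?X (a + n) \<or> ?X j = ?X a \<and> ?X i = ?X (a + n))"
    if "i < N" "j < N" for i j
  proof -
    have "\<exists>a n. 2 * n \<le> N \<and> (n = 0 \<longrightarrow> i = j) \<and>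
      (?X i = ?X a \<and> ?X j = ?X (a + n) \<or> ?X j = ?X a \<and> ?X i = ?X (a + n))"
      if "i \<le> j" "j < N" for i j
    proof (cases "2 * (j - i) \<le> N")
      case True
      then show ?thesis
        using that by (intro exI[of _ i] exI[of _ "j - i"]) auto
    next
      case False
      \<comment> \<open>The complementary arc runs from \<open>j\<close> to \<open>i + N\<close>,
        where periodicity gives \<open>?X i\<close> again.\<close>
      then show ?thesis
        using that period[of i]
        by (intro exI[of _ j] exI[of _ "N - (j - i)"]) (auto simp: algebra_simps)
    qed
    note wlog = this
    show ?thesis
    proof (cases "i \<le> j")
      case True
      from wlog[OF this that(2)] show ?thesis .
    next
      case False
      then have "j \<le> i" by simp
      from wlog[OF this that(1)] obtain a n where "2 * n \<le> N" "n = 0 \<longrightarrow> j = i"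
        "?X j = ?X a \<and> ?X i = ?X (a + n) \<or> ?X i = ?X a \<and> ?X j = ?X (a + n)" by blast
      then show ?thesis by (intro exI[of _ a] exI[of _ n]) blast
    qed
  qed
  have "distinct C"
  proof -
    have "inj_on ?X {0..<N}"
    proof (rule inj_onI)
      fix i j assume ij: "i \<in> {0..<N}" "j \<in> {0..<N}" "?X i = ?X j"
      then have "i < N" "j < N" by simp_all
      from shorter_arc[OF this] obtain a n where an: "2 * n \<le> N" "n = 0 \<longrightarrow> i = j"
        and "?X i = ?X a \<and> ?X j = ?X (a + n) \<or> ?X j = ?X a \<and> ?X i = ?X (a + n)"
        by blast
      \<comment> \<open>Equal end vectors differ nowhere, so \<open>min n k\<close> is 0, and
        \<open>1 \<le> k\<close> leaves only \<open>n = 0\<close>.\<close>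
      then have "differing_positions (?X a) (?X (a + n)) = {}"
        using ij(3) by (auto simp: differing_positions_def)
      with an show "i = j"
        using dist[of n a] k by (cases "n = 0") auto
    qed
    then show ?thesis by (simp add: C_def distinct_map)
  qed
  then have circuit: "circuit d C"
    using N arc unfolding circuit_def len by (simp add: nth mod)
  have G: "pair_graph (cycle_graph C)"
    using circuit by (rule pair_graph_cycle_graph)
  have cycle_arc: "(?X i, ?X (Suc i)) \<in> parcs (cycle_graph C)" for i
  proof -
    have "i mod N < N" using N by simp
    then have "(C ! (i mod N), C ! (Suc (i mod N) mod N)) \<in> cycle_arcs C"
      by (auto simp: cycle_arcs_def len)
    moreover have "C ! (i mod N) = ?X i"
      using nth \<open>i mod N < N\<close> mod by simp
    moreover have "C ! (Suc (i mod N) mod N) = ?X (Suc i)"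
      using nth[of "Suc i mod N"] mod[of "Suc i"] N by (simp add: mod_Suc_eq)
    ultimately show ?thesis by (simp add: cycle_graph_def)
  qed
  have sub: "parcs (cycle_graph C) \<subseteq> parcs (hypercube d)"
  proof -
    have "cycle_arcs C \<subseteq> parcs (hypercube d)"
      using arc N by (auto simp: cycle_arcs_def len nth mod)
    moreover have "(parcs (hypercube d))\<inverse> \<subseteq> parcs (hypercube d)"
      by (auto simp: hypercube_def differing_positions_commute)
    ultimately show ?thesis by (auto simp: cycle_graph_def)
  qed
  have verts: "?X i \<in> pverts (cycle_graph C)" "?X i \<in> pverts (hypercube d)" for i
  proof -
    have "C ! (i mod N) \<in> set C" using N by (simp add: len)
    then show "?X i \<in> pverts (cycle_graph C)"
      using N by (simp add: nth mod cycle_graph_def)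
    show "?X i \<in> pverts (hypercube d)" by (simp add: hypercube_def)
  qed
  have same_dist: "graph_dist (cycle_graph C) (?X a) (?X (a + n)) = graph_dist (hypercube d) (?X a) (?X (a + n))"
    if "2 * n \<le> N" "graph_dist (hypercube d) (?X a) (?X (a + n)) < ereal (real k)" for a n
  proof -
    have "?D (?X a) (?X (a + n)) < k"
      using le_less_trans[OF card_differing_positions_le_graph_dist that(2)] by simp
    \<comment> \<open>The number of differing positions is below \<open>k\<close>, so the minimum in
      \<open>dist\<close> must be \<open>n\<close>.\<close>
    then have "n \<le> ?D (?X a) (?X (a + n))" 
      using dist[OF that(1), of a] by simp
    moreover have "?D (?X a) (?X (a + n)) \<le> n"
    proof -
      obtain p where "pre_digraph.awalk (with_proj (hypercube d)) (?X a) p (?X (a + n))" "length p = n"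
        using walk_along_sequence[of "hypercube d" ?X, OF pair_graph_hypercube verts(2) arc] by blast
      then show ?thesis
        using card_differing_positions_le_walk[OF pair_graph_hypercube order_refl] by blast
    qed
    ultimately have "?D (?X a) (?X (a + n)) = n" by simp
    then show ?thesis
      using graph_dist_along_sequence[of _ d ?X, OF G sub verts(1) cycle_arc]
        graph_dist_along_sequence[of _ d ?X, OF pair_graph_hypercube order_refl verts(2) arc]
      by simp
  qed
  show "circuit_code d k C"
    unfolding circuit_code_def
  proof (intro conjI ballI impI)
    show "circuit d C" by fact
    fix x y assume xy: "x \<in> set C" "y \<in> set C" "graph_dist (hypercube d) x y < ereal (real k)"
    then obtain i j where ij: "i < N" "j < N" "x = ?X i" "y = ?X j"
      by (auto simp: C_def)
    from shorter_arc[OF ij(1,2)] obtain a n where "2 * n \<le> N"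
      and "x = ?X a \<and> y = ?X (a + n) \<or> y = ?X a \<and> x = ?X (a + n)"
      using ij(3,4) by blast
    from this(2) show "graph_dist (cycle_graph C) x y = graph_dist (hypercube d) x y"
    proof
      assume "x = ?X a \<and> y = ?X (a + n)"
      with same_dist[OF \<open>2 * n \<le> N\<close>, of a] xy(3) show ?thesis by simp
    next
      assume "y = ?X a \<and> x = ?X (a + n)"
      with same_dist[OF \<open>2 * n \<le> N\<close>, of a] xy(3) show ?thesis
        unfolding graph_dist_commute[OF G, of x y] graph_dist_commute[OF pair_graph_hypercube, of _ x y]
        by simp
    qed
  qed
qed


text \<open>A position outside \<open>U\<close> carries a value that occurs once in the window,
  hence an odd value, and no two such positions share a value.\<close>

lemma card_odd_values_ge:
  fixes w :: "nat \<Rightarrow> nat" and i n :: nat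
  defines "U \<equiv> {s \<in> {i..<i + n}. \<exists>t \<in> {i..<i + n}. t \<noteq> s \<and> w t = w s}"
  shows "n - card U \<le> card (odd_values w i (i + n))"
proof -
  let ?I = "{i..<i + n}"
  have single: "{t \<in> ?I. w t = w s} = {s}" if "s \<in> ?I - U" for s
    using that by (auto simp: U_def)
  then have sub: "w ` (?I - U) \<subseteq> odd_values w i (i + n)"
    unfolding odd_values_def by fastforce
  have "inj_on w (?I - U)"
    by (rule inj_onI) (auto simp: U_def)
  then have "card (w ` (?I - U)) = card (?I - U)" by (rule card_image)
  also have "\<dots> = n - card U"
    by (subst card_Diff_subset) (auto simp: U_def)
  finally have "n - card U = card (w ` (?I - U))" by simp
  also have "\<dots> \<le> card (odd_values w i (i + n))"
  proof (rule card_mono[OF _ sub])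
    have "v \<in> w ` ?I" if "v \<in> odd_values w i (i + n)" for v
    proof -
      from that have "{s \<in> ?I. w s = v} \<noteq> {}"
        unfolding odd_values_def by (metis (lifting) card.empty even_zero mem_Collect_eq)
      then show ?thesis by auto
    qed
    then have "odd_values w i (i + n) \<subseteq> w ` ?I" by blast
    then show "finite (odd_values w i (i + n))"
      by (rule finite_subset) simp
  qed
  finally show ?thesis .
qed

section \<open>Repeated values in the doubled block\<close>

text \<open>In the interleaved tail the offset \<open>e = 2 * u - 2\<close> yields \<gamma>_u, and
  \<open>e = 2 * u - 1\<close> yields \<beta>_u, since 2(l + u - 1) = 2l + e - 1.\<close>

definition block :: "nat \<Rightarrow> nat \<Rightarrow> nat \<Rightarrow> nat" where
  "block k l r =
    (if r < k + l then r + 1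
     else if r < k + 2 * l - 1 then 2 * (r + 1 - (k + l))
     else let e = r - (k + 2 * l - 1) in if even e then k + l + e div 2 + 1 else 2 * l + e - 1)"

lemma block_tail:
  assumes "1 \<le> l"
  shows "block k l (k + 2 * l - 1 + e) = (if even e then k + l + e div 2 + 1 else 2 * l + e - 1)"
proof -
  have "\<not> k + 2 * l - 1 + e < k + l" "\<not> k + 2 * l - 1 + e < k + 2 * l - 1"
    "k + 2 * l - 1 + e - (k + 2 * l - 1) = e"
    using assms by linarith+
  then show ?thesis unfolding block_def Let_def by presburger
qed

text \<open>
  The even value \<open>2 * j\<close> occurs in the block at the positions \<open>2 * j\<close> and \<open>second k l j\<close>,
  counted from 1, whereas the arguments of \<^const>\<open>block\<close> are counted from 0.
\<close>

definition second :: "nat \<Rightarrow> nat \<Rightarrow> nat \<Rightarrow> nat" where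
  "second k l j = (if j < l then k + l + j else k + 1 + 2 * j)"

text \<open>After the initial run 1, ..., k + l all entries are pairwise distinct, so the earlier of
  two equal entries lies in the run. The later one is then an even value: every \<gamma>_u exceeds k
  + l.\<close>

lemma block_eq_imp:
  assumes "odd k" "2 \<le> l" "even l" "l \<le> k + 1"
    and "r < r'" "r' < 2 * k + l" "block k l r = block k l r'"
  obtains j where "1 \<le> j" "2 * j \<le> k + l - 1" "r = 2 * j - 1" "r' = second k l j - 1"
proof -
  have "r < k + l"
    using assms by (auto simp: block_def Let_def split: if_splits elim!: evenE oddE)
  show ?thesis
  proof (cases "r' < k + 2 * l - 1")
    case True
    with assms \<open>r < k + l\<close> show ?thesis
      by (intro that[of "r' + 1 - (k + l)"])
        (auto simp: block_def Let_def second_def split: if_splits)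
  next
    case False
    define e where "e = r' - (k + 2 * l - 1)"
    have r': "r' = k + 2 * l - 1 + e" using False by (simp add: e_def)
    have eq: "r + 1 = (if even e then k + l + e div 2 + 1 else 2 * l + e - 1)"
      using assms(2,7) \<open>r < k + l\<close> block_tail[of l k e]
      by (simp only: r') (simp add: block_def)
    \<comment> \<open>An even \<open>e\<close> would give a value above \<open>k + l\<close>. An odd
      \<open>e = 2 * u + 1\<close> gives \<open>2 * (l + u)\<close>, whence the witness
      \<open>l + u\<close>.\<close>
    then have "odd e"
      using \<open>r < k + l\<close> by (auto split: if_splits)
    then obtain u where "e = 2 * u + 1" by (rule oddE)
    with eq r' assms show ?thesis
      by (intro that[of "l + u"]) (auto simp: second_def)
  qed
qed

lemma block_range:
  assumes "2 \<le> l" "l \<le> k + 1" "odd k" "even l" "r < 2 * k + l" "2 * d = 3 * k + l + 1"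
  shows "block k l r \<in> {1..d}"
  using assms by (auto simp: block_def Let_def elim!: evenE oddE)

section \<open>Counting the repeated values in a cyclic window\<close>

lemma card_Un_atLeastAtMost_le:
  fixes a b c d :: nat
  assumes "A \<subseteq> {a..b} \<union> {c..d}"
  shows "card A \<le> (b + 1 - a) + (d + 1 - c)"
proof -
  have "card A \<le> card ({a..b} \<union> {c..d})"
    using assms by (simp add: card_mono)
  also have "\<dots> \<le> card {a..b} + card {c..d}" by (rule card_Un_le)
  finally show ?thesis by simp
qed

lemma card_evens_le:
  fixes A :: "nat set"
  assumes "A \<subseteq> {j. a \<le> 2 * j \<and> 2 * j \<le> b}"
  shows "2 * card A \<le> b + 2 - a"
proof -
  have "{j. a \<le> 2 * j \<and> 2 * j \<le> b} \<subseteq> {(a + 1) div 2..b div 2}" by auto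
  with assms have "A \<subseteq> {(a + 1) div 2..b div 2}" by (rule order_trans)
  then have "card A \<le> b div 2 + 1 - (a + 1) div 2"
    using card_mono[of "{(a + 1) div 2..b div 2}" A] by simp
  then show ?thesis by linarith
qed

text \<open>
  Here \<open>W\<close> is the cyclic window of length \<open>n\<close> starting at \<open>a\<close>. The two occurrences of \<open>2 * j\<close> are more
  than \<open>k\<close> apart either way. A window containing both occurrences only in one cyclic order is
  bounded through the one that runs over every second position; otherwise one counts the values
  missed by the complementary window.
\<close>

lemma card_repeated_le:
  fixes k l a n :: nat
  assumes "odd k" "2 \<le> l" "even l" "l \<le> k + 1" "a < 2 * k + l" "n \<le> 2 * k + l"
  defines "L \<equiv> 2 * k + l"
  defines "W \<equiv> \<lambda>r. a \<le> r \<and> r < a + n \<or> r + L < a + n"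
  defines "R \<equiv> {j. 1 \<le> j \<and> 2 * j \<le> k + l - 1 \<and> W (2 * j - 1) \<and> W (second k l j - 1)}"
  shows "2 * card R \<le> n - k"
proof -
  define M where "M = (k + l - 1) div 2"
  have M: "2 * M + 1 = k + l"
    using assms by (auto simp: M_def elim!: evenE oddE)
  \<comment> \<open>The part of the window that wraps around is \<open>{0..<c}\<close>; truncation
    gives 0 if there is none.\<close>
  define c where "c = a + n - L"
  have c: "c \<le> a" using assms by (simp add: c_def)
  \<comment> \<open>The first two bounds say that the occurrences are at least \<open>k + 1\<close>
    apart in either cyclic direction, as L - (k + l - 1) = k + 1.\<close>
  have gap: "2 * j + k + 1 \<le> second k l j" "second k l j + 1 \<le> 2 * j + k + l"
    "k + l < second k l j" "second k l j \<le> L" if "1 \<le> j" "2 * j \<le> k + l - 1" for j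
    using that assms(2-4) by (auto simp: second_def L_def)
  \<comment> \<open>First occurrences lie before index \<open>k + l\<close>, second ones from there
    on. In cases 1 and 3 the window contains all first, respectively all second, occurrences; in
    cases 2 and 4 a pair lies in it in one cyclic order only.\<close>
  consider "k + l \<le> c" | "a \<le> k + l" "a + n \<le> L" | "a \<le> k + l" "L < a + n" | "c < k + l" "k + l < a"
    using c by linarith
  then show ?thesis
  proof cases
    case 1
    \<comment> \<open>For \<open>1 \<le> j\<close>, \<open>second k l j\<close> is the maximum of k
      + l + j and k + 1 + 2j, so its inverse is the minimum of the two inverses.\<close>
    define h where "h x = min (x - k - l) ((x - k - 1) div 2)" for x :: nat
    have h: "second k l j \<le> x \<longleftrightarrow> j \<le> h x" if "1 \<le> j" for j x
      using that assms(2) by (auto simp: second_def h_def)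
    have "R \<subseteq> {1..h c} \<union> {h a + 1..M}"
    proof
      fix j assume j: "j \<in> R"
      then have "1 \<le> j" "j \<le> M" using M by (auto simp: R_def)
      moreover have "second k l j \<le> c \<or> \<not> second k l j \<le> a"
        using j gap[of j] by (auto simp: R_def W_def c_def)
      ultimately show "j \<in> {1..h c} \<union> {h a + 1..M}"
        using h[of j c] h[of j a] by auto
    qed
    from card_Un_atLeastAtMost_le[OF this] have "card R \<le> h c + (M - h a)" by simp
    moreover have "2 * (h c + (M - h a)) \<le> n - k"
    proof -
      have a: "k + l \<le> a" "a < 2 * k + l" "a + n = c + 2 * k + l"
        using 1 assms(2,5) c by (auto simp: c_def L_def)
      \<comment> \<open>At \<open>c\<close> both bounds from the minimum hold; at \<open>a\<close>
        one of them is attained, the halved one up to rounding. Using the same one at both ends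
        closes each case.\<close>
      have hc: "h c + k + l \<le> c" "2 * h c + k + 1 \<le> c"
        using 1 assms(2) by (auto simp: h_def)
      have "h a + k + l = a \<or> a \<le> 2 * h a + k + 2"
        using a(1) assms(2) by (auto simp: h_def min_def)
      moreover have "h a \<le> M" using a M by (auto simp: h_def)
      then obtain y where "M = h a + y" using le_Suc_ex by blast
      moreover have "k \<le> n" using a c 1 by linarith
      then obtain t where "n = k + t" using le_Suc_ex by blast
      ultimately show ?thesis
        using hc a M c by (elim disjE) simp_all
    qed
    ultimately show ?thesis by (meson le_trans mult_le_mono2)
  next
    case 2
    show ?thesis
    proof (cases "n \<le> k")
      case True
      have "j \<notin> R" for j
      proof
        assume j: "j \<in> R"
        then have "1 \<le> j" "2 * j \<le> k + l - 1" by (auto simp: R_def)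
        note g = gap[OF this]
        have "a < 2 * j" "second k l j \<le> a + n"
          using j g 2 \<open>1 \<le> j\<close> by (auto simp: R_def W_def)
        then show False using g True by linarith
      qed
      then have "R = {}" by blast
      then show ?thesis by simp
    next
      case False
      \<comment> \<open>The first occurrence comes after \<open>a\<close>, and at least
        \<open>k + 1\<close> further positions must fit before the window ends.\<close>
      have "R \<subseteq> {j. a + 1 \<le> 2 * j \<and> 2 * j \<le> a + n - k - 1}"
      proof
        fix j assume j: "j \<in> R"
        then have "1 \<le> j" "2 * j \<le> k + l - 1" by (auto simp: R_def)
        note g = gap[OF this]
        have "a < 2 * j" "second k l j \<le> a + n"
          using j g 2 \<open>1 \<le> j\<close> by (auto simp: R_def W_def)
        then show "j \<in> {j. a + 1 \<le> 2 * j \<and> 2 * j \<le> a + n - k - 1}"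
          using g by auto
      qed
      from card_evens_le[OF this] False show ?thesis by simp
    qed
  next
    case 3
    \<comment> \<open>All second occurrences lie in the window, so only first occurrences in the gap
      from \<open>c\<close> to \<open>a\<close> are lost.\<close>
    have "R \<subseteq> {j. a + 1 \<le> 2 * j \<and> 2 * j \<le> 2 * M} \<union> {j. 2 \<le> 2 * j \<and> 2 * j \<le> c}"
    proof
      fix j assume j: "j \<in> R"
      then have "1 \<le> j" "2 * j \<le> 2 * M" "2 * j - 1 < c \<or> a \<le> 2 * j - 1"
        using M by (auto simp: R_def W_def c_def)
      then show "j \<in> {j. a + 1 \<le> 2 * j \<and> 2 * j \<le> 2 * M} \<union> {j. 2 \<le> 2 * j \<and> 2 * j \<le> c}"
        by auto
    qed
    then have "card R \<le> card ({j. a + 1 \<le> 2 * j \<and> 2 * j \<le> 2 * M} \<union> {j. 2 \<le> 2 * j \<and> 2 * j \<le> c})"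
      by (rule card_mono[rotated]) (auto intro: finite_subset[of _ "{..M}"] finite_subset[of _ "{..c}"])
    also have "\<dots> \<le> card {j. a + 1 \<le> 2 * j \<and> 2 * j \<le> 2 * M} + card {j. 2 \<le> 2 * j \<and> 2 * j \<le> c}"
      by (rule card_Un_le)
    finally have "2 * card R \<le> (2 * M + 2 - (a + 1)) + (c + 2 - 2)"
      using card_evens_le[OF order_refl, of "a + 1" "2 * M"] card_evens_le[OF order_refl, of 2 c]
      by linarith
    moreover have "a + n = c + 2 * k + l" using 3 by (simp add: c_def L_def)
    ultimately show ?thesis using M 3 by linarith
  next
    case 4
    \<comment> \<open>Here the pair is met with its second occurrence first, so the upper bound on
      the distance between the occurrences gives the lower bound on \<open>j\<close>.\<close>
    have "R \<subseteq> {j. a + 2 - k - l \<le> 2 * j \<and> 2 * j \<le> c}"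
    proof
      fix j assume j: "j \<in> R"
      then have "1 \<le> j" "2 * j \<le> k + l - 1" by (auto simp: R_def)
      note g = gap[OF this]
      have "2 * j \<le> c" "a < second k l j"
        using j g 4 by (auto simp: R_def W_def c_def)
      then show "j \<in> {j. a + 2 - k - l \<le> 2 * j \<and> 2 * j \<le> c}"
        using g by auto
    qed
    from card_evens_le[OF this] have *: "2 * card R \<le> c + 2 - (a + 2 - k - l)" .
    show ?thesis
    proof (cases "L < a + n")
      case True
      then have "a + n = c + 2 * k + l" by (simp add: c_def L_def)
      with * 4 show ?thesis by linarith
    next
      case False
      then have "c = 0" by (simp add: c_def)
      with * 4 show ?thesis by linarith
    qed
  qed
qed

text \<open>A window of at most one period reduces injectively modulo the period, and its repeated
  positions fall into the pairs indexed by \<open>R\<close>. So at most \<open>2 * card R\<close>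
  positions are lost.\<close>

lemma min_le_card_odd_values_block:
  assumes "odd k" "2 \<le> l" "even l" "l \<le> k + 1" "n \<le> 2 * k + l"
  shows "min n k \<le> card (odd_values (\<lambda>s. block k l (s mod (2 * k + l))) a (a + n))"
proof -
  define L where "L = 2 * k + l"
  let ?I = "{a..<a + n}"
  let ?w = "\<lambda>s. block k l (s mod L)"
  let ?W = "\<lambda>r. a mod L \<le> r \<and> r < a mod L + n \<or> r + L < a mod L + n"
  define R where "R = {j. 1 \<le> j \<and> 2 * j \<le> k + l - 1 \<and> ?W (2 * j - 1) \<and> ?W (second k l j - 1)}"
  define U where "U = {s \<in> ?I. \<exists>t \<in> ?I. t \<noteq> s \<and> ?w t = ?w s}"
  have L: "0 < L" "n \<le> L" using assms by (simp_all add: L_def)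
  have W: "?W (s mod L)" if "s \<in> ?I" for s
  proof -
    define i where "i = s - a"
    then have i: "s = a + i" "i < n" using that by auto
    then have "s mod L = (a mod L + i) mod L" by (simp add: mod_add_left_eq)
    moreover have "a mod L + i - L < L"
      using i(2) L mod_less_divisor[OF L(1), of a] by linarith
    ultimately have "s mod L = (if a mod L + i < L then a mod L + i else a mod L + i - L)"
      by (simp add: le_mod_geq)
    then show ?thesis using i(2) by auto
  qed
  have inj: "inj_on (\<lambda>s. s mod L) ?I"
  proof (rule linorder_inj_onI')
    fix s t assume st: "s \<in> ?I" "t \<in> ?I" "s < t"
    then have "\<not> L dvd t - s"
      using L by (intro nat_dvd_not_less) auto
    with st(3) show "s mod L \<noteq> t mod L"
      using mod_eq_dvd_iff_nat[of s t L] by (metis less_imp_le)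
  qed
  have "R \<subseteq> {..k + l}"
  proof
    fix j assume "j \<in> R"
    then have "2 * j \<le> k + l - 1" unfolding R_def by blast
    then show "j \<in> {..k + l}" by simp
  qed
  then have "finite R" by (rule finite_subset) simp
  have pair: "\<exists>j \<in> R. {r, r'} = {2 * j - 1, second k l j - 1}"
    if "r < L" "r' < L" "?W r" "?W r'" "r \<noteq> r'" "block k l r = block k l r'" for r r'
  proof -
    have "\<exists>j \<in> R. {r, r'} = {2 * j - 1, second k l j - 1}"
      if r: "r < r'" "r' < L" "?W r" "?W r'" "block k l r = block k l r'" for r r'
    proof -
      obtain j where "1 \<le> j" "2 * j \<le> k + l - 1" "r = 2 * j - 1" "r' = second k l j - 1"
        using block_eq_imp[OF assms(1-4) r(1) r(2)[unfolded L_def] r(5)] .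
      with r(3,4) show ?thesis
        unfolding R_def by (intro bexI[of _ j]) simp_all
    qed
    note ordered = this
    show ?thesis
    proof (cases "r < r'")
      case True
      from ordered[OF this that(2-4,6)] show ?thesis .
    next
      case False
      with that(5) have "r' < r" by simp
      from ordered[OF this that(1,4,3) that(6)[symmetric]] show ?thesis
        by (simp only: insert_commute[of r])
    qed
  qed
  have "(\<lambda>s. s mod L) ` U \<subseteq> (\<Union>j \<in> R. {2 * j - 1, second k l j - 1})"
  proof
    fix r assume "r \<in> (\<lambda>s. s mod L) ` U"
    then obtain s t where st: "s \<in> ?I" "t \<in> ?I" "t \<noteq> s" "?w t = ?w s" "r = s mod L"
      by (auto simp: U_def)
    then have "s mod L \<noteq> t mod L" using inj by (auto dest: inj_onD)
    then obtain j where "j \<in> R" "{s mod L, t mod L} = {2 * j - 1, second k l j - 1}"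
      using pair[of "s mod L" "t mod L"] W st L(1) by auto
    then show "r \<in> (\<Union>j \<in> R. {2 * j - 1, second k l j - 1})"
      using st(5) by blast
  qed
  then have "card ((\<lambda>s. s mod L) ` U) \<le> card (\<Union>j \<in> R. {2 * j - 1, second k l j - 1})"
    using \<open>finite R\<close> by (intro card_mono) auto
  also have "\<dots> \<le> (\<Sum>j \<in> R. card {2 * j - 1, second k l j - 1})"
    by (rule card_UN_le[OF \<open>finite R\<close>])
  also have "\<dots> \<le> (\<Sum>j \<in> R. 2)"
    by (intro sum_mono) (simp add: card_insert_if)
  finally have "card ((\<lambda>s. s mod L) ` U) \<le> 2 * card R" by simp
  moreover have "card ((\<lambda>s. s mod L) ` U) = card U"
    by (rule card_image, rule inj_on_subset[OF inj]) (auto simp: U_def)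
  moreover have "2 * card R \<le> n - k"
    unfolding R_def L_def
    by (rule card_repeated_le[OF assms(1-4) _ assms(5)]) (use L in \<open>simp add: L_def\<close>)
  moreover have "n - card U \<le> card (odd_values ?w a (a + n))"
    unfolding U_def by (rule card_odd_values_ge)
  \<comment> \<open>With truncated subtraction, n - (n - k) is \<open>min n k\<close>.\<close>
  ultimately show ?thesis by (simp add: L_def)
qed

section \<open>From the listed sequence to the circuit code\<close>

lemma concat_map_pairs:
  "concat (map (\<lambda>u. [f u, g u]) [1..<m + 1]) =
     map (\<lambda>e. if even e then f (e div 2 + 1) else g (e div 2 + 1)) [0..<2 * m]"
  by (induction m) auto

lemma concat_conv_block:
  assumes "2 \<le> l" "l + 2 * m = k + 1"
    and "\<forall>u \<in> {1..m}. \<beta> u = 2 * (l + u - 1)" and "\<forall>u \<in> {1..m}. \<gamma> u = k + l + u"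
  shows "[1..<k + l + 1] @ map (\<lambda>j. 2 * j) [1..<l] @ concat (map (\<lambda>u. [\<gamma> u, \<beta> u]) [1..<m + 1])
    = map (block k l) [0..<2 * k + l]" (is "?A @ ?B @ ?C = _")
proof (rule nth_equalityI)
  have C: "?C = map (\<lambda>e. if even e then \<gamma> (e div 2 + 1) else \<beta> (e div 2 + 1)) [0..<2 * m]"
    by (rule concat_map_pairs)
  then have len: "length ?A = k + l" "length ?B = l - 1" "length ?C = 2 * m" by (simp_all del: upt_Suc)
  then show L: "length (?A @ ?B @ ?C) = length (map (block k l) [0..<2 * k + l])"
    using assms(1,2) by (simp only: length_append len) simp
  fix r assume "r < length (?A @ ?B @ ?C)"
  then have r: "r < 2 * k + l" using L by simp
  consider "r < k + l" | "k + l \<le> r" "r < k + 2 * l - 1" | e where "r = k + 2 * l - 1 + e"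
    by (metis le_add_diff_inverse not_less)
  then show "(?A @ ?B @ ?C) ! r = map (block k l) [0..<2 * k + l] ! r"
  proof cases
    case 1
    then show ?thesis using r by (simp add: nth_append len block_def del: upt_Suc)
  next
    case 2
    define i where "i = r - (k + l)"
    have "r = k + l + i" "i < l - 1" "k + l + i < k + 2 * l - 1" using 2 by (auto simp: i_def)
    then show ?thesis using r by (simp add: nth_append block_def del: upt_Suc)
  next
    case 3
    then have "e < 2 * m" using r assms by simp
    then have "?C ! e = (if even e then k + l + e div 2 + 1 else 2 * l + e - 1)"
      using assms(1,3,4) unfolding C by (auto elim!: oddE)
    moreover have "(?A @ ?B @ ?C) ! r = ?C ! e"
    proof -
      have "r = length (?A @ ?B) + e" using 3 assms(1) len by simp
      then show ?thesis
        by (simp only: append_assoc[symmetric] nth_append_length_plus)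
    qed
    ultimately show ?thesis using 3 r assms(1) block_tail[of l k e] by simp
  qed
qed

lemma max_bit_run_ge:
  assumes "transition_sequence C = xs @ ys" "distinct xs"
  shows "length xs \<le> max_bit_run C"
  unfolding max_bit_run_def
proof (rule Max_ge)
  show "finite {length s |s. s \<in> segments (transition_sequence C) \<and> distinct s}"
    by (rule finite_subset[of _ "{..length (transition_sequence C)}"]) (auto simp: segments_def)
  have "xs = take (length xs) (rotate 0 (transition_sequence C))" "length xs \<le> length (transition_sequence C)"
    using assms by simp_all
  then have "xs \<in> segments (transition_sequence C)"
    unfolding segments_def by blast
  then show "length xs \<in> {length s |s. s \<in> segments (transition_sequence C) \<and> distinct s}"
    using assms(2) by blast
qed

theorem lemma3p8:
  fixes k l d m :: nat
    and \<beta> \<gamma> :: "nat \<Rightarrow> nat"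
    and S T :: "nat list"
  assumes "1 \<le> k" and "odd k"
    and "2 \<le> l" and "even l" and "l \<le> k + 1"
    and "real d = 3 * real k / 2 + (real l + 1) / 2"
    and "real m = real d - (real k + real l)"
    and "\<forall>u \<in> {1..m}. \<beta> u = 2 * (l + u - 1)"
    and "\<forall>u \<in> {1..m}. \<gamma> u = k + l + u"
    and "S = [1..<k + l + 1] @ map (\<lambda>j. 2 * j) [1..<l] @ concat (map (\<lambda>u. [\<gamma> u, \<beta> u]) [1..<m + 1])"
    and "T = S @ S"
  shows "\<exists>C \<in> circuit_codes_run d k (k + l).
           hd C = replicate d False \<and> transition_sequence C = T \<and>
           symmetric_circuit C \<and> length C = 4 * k + 2 * l"
proof -
  define L where "L = 2 * k + l"
  define w where "w s = block k l (s mod L)" for s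
  define C where "C = map (prefix_vector d w) [0..<2 * L]"
  \<comment> \<open>Doubling clears the halves, so that the equations descend to the natural
    numbers.\<close>
  have "real (2 * d) = real (3 * k + l + 1)" "real (l + 2 * m) = real (k + 1)"
    using assms(6,7) by (simp_all add: field_simps)
  then have d: "2 * d = 3 * k + l + 1" and m: "l + 2 * m = k + 1"
    by (simp_all only: of_nat_eq_iff)
  have L: "3 \<le> 2 * L" using assms by (simp add: L_def)
  have S: "S = map (block k l) [0..<L]"
    unfolding assms(10) L_def by (rule concat_conv_block[OF assms(3) m assms(8,9)])
  have T: "map w [0..<2 * L] = T"
  proof -
    have "map w [0..<2 * L] = map w [0..<L] @ map w [L..<L + L]"
      by (simp only: mult_2 upt_add_eq_append[of 0 L L, OF le0] map_append)
    moreover have "map w [L..<L + L] = map w [0..<L]"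
      by (rule nth_equalityI) (simp_all add: w_def)
    moreover have "map w [0..<L] = S"
      by (simp add: S w_def)
    ultimately show ?thesis by (simp add: assms(11))
  qed
  have range: "range w \<subseteq> {1..d}"
  proof
    fix v assume "v \<in> range w"
    then obtain s where "v = block k l (s mod L)" by (auto simp: w_def)
    moreover have "s mod L < 2 * k + l" using assms(3) by (simp add: L_def)
    ultimately show "v \<in> {1..d}" using block_range[OF assms(3,5,2,4) _ d] by simp
  qed
  have period: "w (s + L) = w s" for s by (simp add: w_def)
  then have period2: "w (s + 2 * L) = w s" for s by (metis add.assoc mult_2)
  \<comment> \<open>Both copies of the block contribute the same count.\<close>
  have closed: "even (card {s \<in> {0..<2 * L}. w s = v})" for v
    using card_occurrences_split[of L "2 * L" w v] card_periodic_occurrences[of w L L v, OF period]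
    by (simp add: mult_2)
  have spread: "min n k \<le> card (odd_values w a (a + n))" if "2 * n \<le> 2 * L" for a n
    using min_le_card_odd_values_block[OF assms(2-5), of n a] that
    by (simp add: L_def w_def[abs_def])
  have code: "circuit_code d k C" and ts: "transition_sequence C = T"
    using circuit_code_of_transitions[OF range period2 closed L assms(1) spread] T
    by (simp_all add: C_def)
  \<comment> \<open>The run 1, ..., k + l is a repetition-free prefix of \<open>T\<close>.\<close>
  have "length [1..<k + l + 1] \<le> max_bit_run C"
    by (rule max_bit_run_ge) (simp_all add: ts assms(10,11) del: upt_Suc)
  then have "C \<in> circuit_codes_run d k (k + l)"
    using code by (simp add: circuit_codes_run_def del: upt_Suc)
  moreover have "hd C = replicate d False"
    using L by (simp add: C_def hd_map prefix_vector_def map_replicate_const)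
  moreover have "symmetric_circuit C"
  proof -
    have "length C div 2 = L" by (simp add: C_def)
    then show ?thesis
      by (simp add: symmetric_circuit_def ts assms(11) S nth_append) (simp add: C_def)
  qed
  moreover have "length C = 4 * k + 2 * l" by (simp add: C_def L_def)
  ultimately show ?thesis using ts by blast
qed

end
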